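(* Let $n$ be a positive integer and let $\mathcal{F}\subseteq 2^{[n]}$ be a family of subsets of $[n]=\{1,\dots,n\}$. Then there exists an element $i\in[n]$ such that at least half of the sets in $\mathcal{F}$ contain $i$ if and only if there exists a family $\mathcal{G}\subseteq 2^{[n]}$ with $|\mathcal{G}|>1$ such that $$\sum_{S\in\mathcal{F}}\log|\mathcal{G}(S)|\leq\frac{|\mathcal{F}|\log|\mathcal{G}|}{2}.$$
   Context: All logarithms are base $2$. For a set $S\subseteq[n]$ and a family $\mathcal{G}\subseteq 2^{[n]}$, $\mathcal{G}(S)$ denotes the family $\{S\cup G : G\in\mathcal{G}\}$ (as a set of sets, so $|\mathcal{G}(S)|$ counts distinct sets of this form). *)

theory Defs
  imports Complex_Main
begin

definition union_family :: "'a set set \<Rightarrow> 'a set \<Rightarrow> 'a set set" where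
  "union_family \<G> S = {S \<union> G | G. G \<in> \<G>}"

end

theory Submission
  imports Defs
begin

text \<open>
  If \<open>i\<close> lies in at least half of the sets, take \<open>\<G> = {{}, {i}}\<close>. Conversely, if every \<open>i\<close> is
  missing from more than half of the sets, apply Shearer's inequality to the complements: the number
  of sets \<open>S \<union> G\<close> is the size of the trace of \<open>\<G>\<close> on the complement of \<open>S\<close>, and these complements
  cover every point at least \<open>(|\<F>| + 1) / 2\<close> times. Shearer's inequality is proved by induction on
  the ground set, splitting \<open>\<G>\<close> according to membership of one point and weighting the two
  resulting inequalities by the proportions of the two parts.
\<close>

text \<open>Gibbs' inequality for the distributions \<open>(p, q)\<close> and
  \<open>(x, y) / (x + y)\<close>: add \<open>ln t \<le> t - 1\<close> at
  \<open>t = x / (p * (x + y))\<close> with weight \<open>p\<close> and at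
  \<open>t = y / (q * (x + y))\<close> with weight \<open>q\<close>.\<close>

lemma weighted_ln_add_entropy_le:
  fixes p q x y :: real
  assumes "p > 0" "q > 0" "p + q = 1" "x > 0" "y > 0"
  shows "p * ln x + q * ln y - (p * ln p + q * ln q) \<le> ln (x + y)"
proof -
  have gibbs: "r * (ln z - ln r - ln (x + y)) \<le> z / (x + y) - r" if "r > 0" "z > 0" for r z
  proof -
    have "ln z - ln r - ln (x + y) = ln (z / (r * (x + y)))"
      using that assms by (simp add: ln_div ln_mult)
    also have "\<dots> \<le> z / (r * (x + y)) - 1"
      using that assms by (intro ln_le_minus_one) simp
    finally have "r * (ln z - ln r - ln (x + y)) \<le> r * (z / (r * (x + y)) - 1)"
      using that by (intro mult_left_mono) auto
    also have "\<dots> = z / (x + y) - r"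
      using that assms by (simp add: right_diff_distrib)
    finally show ?thesis .
  qed
  have "x / (x + y) + y / (x + y) = 1"
    using assms by (simp add: add_divide_distrib [symmetric])
  then have "p * (ln x - ln p - ln (x + y)) + q * (ln y - ln q - ln (x + y)) \<le> 0"
    using gibbs[of p x] gibbs[of q y] assms by linarith
  moreover have "p * ln (x + y) + q * ln (x + y) = ln (x + y)"
    using assms by (metis distrib_right mult_1)
  ultimately show ?thesis by (simp add: algebra_simps)
qed

text \<open>
  Asking the members of \<open>\<G>\<close> only to agree outside \<open>V\<close>, rather than to be subsets of \<open>V\<close>, lets the
  induction hypothesis apply to the members containing the new point without removing it from them.
\<close>

lemma shearer_union:
  fixes k :: real
  assumes "finite V" and "finite \<F>" and "finite \<G>" and "\<G> \<noteq> {}"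
    and "\<And>X Y. X \<in> \<G> \<Longrightarrow> Y \<in> \<G> \<Longrightarrow> X - V = Y - V"
    and "\<And>i. i \<in> V \<Longrightarrow> k \<le> real (card {S \<in> \<F>. i \<notin> S})"
  shows "k * ln (real (card \<G>)) \<le> (\<Sum>S\<in>\<F>. ln (real (card ((\<union>) S ` \<G>))))"
  using assms(1,3-)
proof (induction V arbitrary: \<G> rule: finite_induct)
  case empty
  \<comment> \<open>Agreement outside the empty set leaves a single member, so both sides are 0
    whatever the sign of \<open>k\<close>.\<close>
  then obtain X where "\<G> = {X}" by (metis Diff_empty ex_in_conv is_singletonI' is_singleton_def)
  then show ?case by simp
next
  case (insert v V)
  define A where "A = {X \<in> \<G>. v \<in> X}"
  define B where "B = {X \<in> \<G>. v \<notin> X}"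
  have AB: "\<G> = A \<union> B" "A \<inter> B = {}" "finite A" "finite B"
    using insert.prems by (auto simp: A_def B_def)
  have agree: "X - V = Y - V"
    if "X \<in> \<G>" "Y \<in> \<G>" "v \<in> X \<longleftrightarrow> v \<in> Y" for X Y
    using insert.prems(3)[OF that(1,2)] that(3) by blast
  have IH: "k * ln (real (card \<H>)) \<le> (\<Sum>S\<in>\<F>. ln (real (card ((\<union>) S ` \<H>))))"
    if "\<H> \<noteq> {}" "\<H> = A \<or> \<H> = B" for \<H>
  proof (rule insert.IH)
    show "finite \<H>" using that AB by auto
    show "X - V = Y - V" if "X \<in> \<H>" "Y \<in> \<H>" for X Y
      using that \<open>\<H> = A \<or> \<H> = B\<close> by (intro agree) (auto simp: A_def B_def)
  qed (use that insert.prems in auto)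
  show ?case
  proof (cases "A = {} \<or> B = {}")
    case True
    then have "\<G> = A \<or> \<G> = B" using AB by auto
    then show ?thesis using IH insert.prems(2) by blast
  next
    case False
    define a where "a = real (card A)"
    define b where "b = real (card B)"
    define p where "p = a / (a + b)"
    define q where "q = b / (a + b)"
    \<comment> \<open>The entropy of the event \<open>v \<in> X\<close> for \<open>X\<close> uniform
      in \<open>\<G>\<close>; \<open>split\<close> below is the corresponding chain rule.\<close>
    define h where "h = - (p * ln p + q * ln q)"
    define x where "x S = real (card ((\<union>) S ` A))" for S
    define y where "y S = real (card ((\<union>) S ` B))" for S
    define z where "z S = real (card ((\<union>) S ` \<G>))" for S
    have ab: "a > 0" "b > 0" using False AB by (auto simp: a_def b_def card_gt_0_iff)
    then have pq: "p > 0" "q > 0" "p + q = 1"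
      by (auto simp: p_def q_def add_divide_distrib [symmetric])
    have xy: "x S > 0" "y S > 0" for S
      using False AB by (auto simp: x_def y_def card_gt_0_iff)
    have "p * ln p \<le> 0" "q * ln q \<le> 0"
      using pq by (auto intro!: mult_nonneg_nonpos)
    then have h0: "h \<ge> 0" by (simp add: h_def)
    have cardG: "real (card \<G>) = a + b"
      using AB by (simp add: a_def b_def card_Un_disjoint)
    have "p * ln a + q * ln b + h = p * ln (a + b) + q * ln (a + b)"
      using ab by (simp add: h_def p_def q_def ln_div algebra_simps)
    also have "\<dots> = ln (a + b)" using pq by (metis distrib_right mult_1)
    finally have split: "ln (a + b) = p * ln a + q * ln b + h" by simp
    \<comment> \<open>If \<open>v \<notin> S\<close>, the point \<open>v\<close> still separates the
      unions from \<open>A\<close> and from \<open>B\<close>, so the counts add and \<open>h\<close>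
      is gained. If \<open>v \<in> S\<close>, the unions may coincide and only monotonicity
      remains.\<close>
    have le: "p * ln (x S) + q * ln (y S) + (if v \<notin> S then h else 0) \<le> ln (z S)" for S
    proof (cases "v \<in> S")
      case False
      then have "(\<union>) S ` A \<inter> (\<union>) S ` B = {}" by (auto simp: A_def B_def)
      then have "z S = x S + y S"
        using AB by (simp add: z_def x_def y_def image_Un card_Un_disjoint)
      then show ?thesis
        using False weighted_ln_add_entropy_le[OF pq xy, of S S] by (simp add: h_def)
    next
      case True
      have "x S \<le> z S" "y S \<le> z S"
        using AB by (auto simp: x_def y_def z_def intro!: card_mono)
      then have "p * ln (x S) \<le> p * ln (z S)" "q * ln (y S) \<le> q * ln (z S)"
        using pq xy[of S] by (auto intro!: mult_left_mono)
      moreover have "p * ln (z S) + q * ln (z S) = ln (z S)"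
        using pq by (metis distrib_right mult_1)
      ultimately show ?thesis using True by simp
    qed
    have "k * ln (a + b) = p * (k * ln a) + q * (k * ln b) + k * h"
      by (simp add: split algebra_simps)
    \<comment> \<open>The covering bound at \<open>v\<close> enters here: \<open>h \<ge> 0\<close>
      is gained once for each \<open>S\<close> missing \<open>v\<close>, hence at least
      \<open>k\<close> times.\<close>
    also have "\<dots> \<le> p * (\<Sum>S\<in>\<F>. ln (x S)) + q * (\<Sum>S\<in>\<F>. ln (y S))
        + real (card {S \<in> \<F>. v \<notin> S}) * h"
      using IH[of A] IH[of B] False pq h0 insert.prems(4)[of v]
      by (intro add_mono mult_left_mono mult_right_mono) (auto simp: a_def b_def x_def y_def)
    also have "\<dots> = (\<Sum>S\<in>\<F>. p * ln (x S) + q * ln (y S) + (if v \<notin> S then h else 0))"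
      using assms(2) by (simp add: sum.distrib sum_distrib_left sum.If_cases Int_def)
    also have "\<dots> \<le> (\<Sum>S\<in>\<F>. ln (z S))"
      by (intro sum_mono le)
    finally show ?thesis by (simp add: cardG z_def)
  qed
qed

lemma union_family_eq_image: "union_family \<G> S = (\<union>) S ` \<G>"
  by (auto simp: union_family_def)

theorem theorem1p2:
  fixes n :: nat and \<F> :: "nat set set"
  assumes "n > 0" and "\<F> \<subseteq> Pow {1..n}"
  shows "(\<exists>i\<in>{1..n}. real (card {S \<in> \<F>. i \<in> S}) \<ge> real (card \<F>) / 2) \<longleftrightarrow>
    (\<exists>\<G>. \<G> \<subseteq> Pow {1..n} \<and> card \<G> > 1 \<and>
      (\<Sum>S\<in>\<F>. log 2 (real (card (union_family \<G> S)))) \<le> real (card \<F>) * log 2 (real (card \<G>)) / 2)"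
    (is "?L \<longleftrightarrow> ?R")
proof -
  have fin: "finite \<F>" using assms(2) by (rule finite_subset) simp
  have compl: "card \<F> = card {S \<in> \<F>. i \<in> S} + card {S \<in> \<F>. i \<notin> S}" for i
    using fin by (subst card_Un_disjoint [symmetric]) (auto intro: arg_cong[where f = card])
  show ?thesis
  proof
    assume ?L
    then obtain i where i: "i \<in> {1..n}" "real (card {S \<in> \<F>. i \<in> S}) \<ge> real (card \<F>) / 2"
      by blast
    let ?G = "{{}, {i}}"
    \<comment> \<open>The two unions coincide exactly when \<open>i \<in> S\<close>, so the sum
      counts the sets missing \<open>i\<close>.\<close>
    have "log 2 (real (card (union_family ?G S))) = (if i \<notin> S then 1 else 0)" for S
    proof (cases "i \<in> S")
      case True
      then have "union_family ?G S = {S}" by (auto simp: union_family_eq_image)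
      then show ?thesis using True by simp
    next
      case False
      then have "S \<noteq> insert i S" by blast
      then show ?thesis using False by (simp add: union_family_eq_image)
    qed
    then have "(\<Sum>S\<in>\<F>. log 2 (real (card (union_family ?G S)))) = real (card {S \<in> \<F>. i \<notin> S})"
      using fin by (simp add: sum.If_cases Int_def)
    also have "\<dots> \<le> real (card \<F>) * log 2 (real (card ?G)) / 2"
      using i(2) compl[of i] by simp
    finally show ?R using i(1) by (intro exI[of _ ?G]) auto
  next
    assume ?R
    then obtain \<G> where G: "\<G> \<subseteq> Pow {1..n}" "card \<G> > 1"
      and le: "(\<Sum>S\<in>\<F>. log 2 (real (card (union_family \<G> S))))
        \<le> real (card \<F>) * log 2 (real (card \<G>)) / 2"
      by blast
    show ?L
    proof (rule ccontr)
      assume contra: "\<not> ?L"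
      \<comment> \<open>By integrality, more than \<open>card \<F> / 2\<close> means at least
        \<open>(card \<F> + 1) / 2\<close>. The surplus \<open>1 / 2\<close> is what contradicts the
        non-strict bound \<open>le\<close>.\<close>
      have "(real (card \<F>) + 1) / 2 * ln (real (card \<G>))
          \<le> (\<Sum>S\<in>\<F>. ln (real (card ((\<union>) S ` \<G>))))"
      proof (rule shearer_union[of "{1..n}"])
        show "finite \<G>" "\<G> \<noteq> {}" using G(2) by (auto intro: card_ge_0_finite)
        show "X - {1..n} = Y - {1..n}" if "X \<in> \<G>" "Y \<in> \<G>" for X Y
          using that G(1) by blast
        show "(real (card \<F>) + 1) / 2 \<le> real (card {S \<in> \<F>. i \<notin> S})" if "i \<in> {1..n}" for i
        proof -
          have "real (card {S \<in> \<F>. i \<in> S}) < real (card \<F>) / 2"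
            using contra that by force
          then have "card \<F> + 1 \<le> 2 * card {S \<in> \<F>. i \<notin> S}"
            using compl[of i] by simp
          then show ?thesis by simp
        qed
      qed (use fin in auto)
      then have "(real (card \<F>) + 1) / 2 * ln (real (card \<G>)) / ln 2
          \<le> (\<Sum>S\<in>\<F>. ln (real (card ((\<union>) S ` \<G>)))) / ln 2"
        by (intro divide_right_mono) auto
      also have "\<dots> = (\<Sum>S\<in>\<F>. log 2 (real (card (union_family \<G> S))))"
        by (simp add: union_family_eq_image log_def sum_divide_distrib)
      also note le
      finally have "log 2 (real (card \<G>)) \<le> 0"
        by (simp add: log_def field_simps mult_le_0_iff)
      moreover have "log 2 (real (card \<G>)) > 0" using G(2) by simp
      ultimately show False by linarith
    qed
  qed
qed

end
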